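(* Let $N$ be a fixed positive integer, and let $N=\ldots,0,0,N_{\alpha-1},N_{\alpha-2},\ldots,N_1,N_0$ denote its radix $2$ representation (with $\alpha$ binary digits). Let $$\beta=\left\lfloor (1+\alpha)/2\right\rfloor,$$ and let $x$ denote the positive odd generic rational integer $$x=\ldots,0,0,x_{\beta-1},x_{\beta-2},\ldots,x_2,x_1,1$$ in $\mathbb{G}\langle\mathbf{x}\rangle$ (so the $i$-th component of $x$ is $0$ for $i\ge\beta$). Let $c^{(0)}=N$, $borrows^{(0)}=0$, and for $i\ge0$ $$c^{(i+1)}=\mathrm{Component\_Wise}\_\sigma_1\bigl(c^{(i)},borrows^{(i)},c^{(i)}_i\diamond\mathcal{S}^i x\bigr),$$ $$borrows^{(i+1)}=\mathcal{S}\,\mathrm{Component\_Wise}\_\sigma_2\bigl(c^{(i)\ast},borrows^{(i)},c^{(i)}_i\diamond\mathcal{S}^i x\bigr).$$ Let $$\Gamma=\left\lceil (1+\alpha)/2\right\rceil,$$ and for $k\ge0$ let $e_k$ denote the element $$e_k=\prod_{i=0}^{\infty}\bigl(c^{(k)}_i\dotplus borrows^{(k)}_i\dotplus1\bigr)$$ of $\mathbb{B}\langle\mathbf{x}\rangle$. Then $N$ has an odd integer factor of length $\beta-j$ ($0\le j\le\beta-1$) if and only if there exists an instantiation $\Phi$ such that $$\Phi(x_{\beta-p})=0\ \text{ for }1\le p\le j,\qquad \Phi(x_{\beta-(j+1)})=1,\qquad \Phi(e_{\Gamma+1})=1.$$ Moreover, if there exists such an instantiation $\Phi$, then $N$ is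 the product of the two positive integers $\Phi(x)$ and $$N/\Phi(x)=\Phi\bigl(\ldots,0,c^{(\Gamma+j-1)}_{\Gamma+j-1},c^{(\Gamma+j-2)}_{\Gamma+j-2},\ldots,c^{(1)}_1,c^{(0)}_0\bigr).$$
   Context: A Boolean ring is a ring with $1$ in which every element is idempotent; its addition is written $\dotplus$ and its multiplication $\diamond$. $\mathbb{B}\langle\mathbf{x}\rangle$ is the free Boolean ring on a finite set of symbols $\mathbf{x}=\{x_0,\ldots,x_{\nu-1}\}$, where $\nu\ge\beta$; $\mathbb{B}\langle\ \rangle=\mathbb{F}_2$. The product defining $e_k$ is with respect to $\diamond$; almost all its factors are $1$. A generic dyadic integer is an infinite sequence $e=\ldots,e_2,e_1,e_0$ of elements $e_i\in\mathbb{B}\langle\mathbf{x}\rangle$ (its components); it is a generic rational integer if its components are eventually constant. $\mathbb{G}_{(2)}\langle\mathbf{x}\rangle$ and $\mathbb{G}\langle\mathbf{x}\rangle$ denote the sets of generic dyadic and generic rational integers. Ordinary integers are included via their ($2$-adic) binary expansions, with bits $0,1\in\mathbb{B}\langle\mathbf{x}\rangle$. A generic integer is odd if its $0$-th component is $1$, and positive if it is nonzero and almost all its components are $0$. The left shift is $\mathcal{S}u=\ldots,u_2,u_1,u_0,0$. The component-wise complement $u^\ast$ has $i$-th component $1\dotplus u_i$. For $t\in\mathbb{B}\langle\mathbf{x}\rangle$, $t\diamond u$ has $i$-th component $t\diamond u_i$. $\mathrm{Component\_Wise}\_\sigma_1(u,v,w)$ has $i$-th component $u_i\dotplus v_i\dotplus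 w_i$, and $\mathrm{Component\_Wise}\_\sigma_2(u,v,w)$ has $i$-th component $(u_i\diamond v_i)\dotplus(v_i\diamond w_i)\dotplus(w_i\diamond u_i)$. $c^{(i)}_j$ denotes the $j$-th component of $c^{(i)}$. An instantiation is a map $\Phi:\mathbf{x}\to\mathbb{F}_2$; it extends uniquely to a Boolean ring homomorphism $\Phi:\mathbb{B}\langle\mathbf{x}\rangle\to\mathbb{F}_2$, and, applied component by component, to a map from generic rational (dyadic) integers to integers (dyadic integers), the image being the (dyadic) integer with the resulting binary expansion. The length of a positive integer $a$ is $j+1$, where $j$ is the largest index with binary digit $a_j=1$.
   Formalization: The condition Φ(e_{Γ+1})=1 is replaced by Φ(e_{Γ+j})=1, matching the Γ+j quotient digits; as printed the claim fails, e.g. N=16, j=2: the factor 1 has length β−j=1, but Φ(x)=1 is forced and Φ(e_4)=0. *)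

theory Defs
  imports Complex_Main "HOL-Algebra.Ring" "HOL-Library.Z2"
begin

section \<open>The free Boolean ring on \<open>x\<^sub>0, \<dots>, x\<^sub>\<nu>\<^sub>-\<^sub>1\<close>\<close>

text \<open>
  Elements are the square-free polynomials over \<open>\<bbbF>\<^sub>2\<close> in the symbols \<open>x\<^sub>0, \<dots>, x\<^sub>\<nu>\<^sub>-\<^sub>1\<close>. A
  monomial is the set of the indices of its symbols, so that the product of monomials is their
  union, and a polynomial is the set of its monomials.
\<close>

definition free_boolean_ring :: "nat \<Rightarrow> nat set set ring" where
  "free_boolean_ring \<nu> =
    \<lparr>carrier = Pow (Pow {..<\<nu>}),
     mult = (\<lambda>p q. {M. odd (card {(A, B). A \<in> p \<and> B \<in> q \<and> A \<union> B = M})}),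
     one = {{}},
     zero = {},
     add = (\<lambda>p q. (p - q) \<union> (q - p))\<rparr>"

definition symb :: "nat \<Rightarrow> nat set set" where
  "symb i = {{i}}"

definition poly_ext :: "(nat \<Rightarrow> 'a::comm_ring_1) \<Rightarrow> nat set set \<Rightarrow> 'a" where
  "poly_ext f p = (\<Sum>M\<in>p. \<Prod>i\<in>M. f i)"

lemma carrier_free_boolean_ring: "carrier (free_boolean_ring \<nu>) = Pow (Pow {..<\<nu>})"
  and one_free_boolean_ring: "\<one>\<^bsub>free_boolean_ring \<nu>\<^esub> = {{}}"
  and zero_free_boolean_ring: "\<zero>\<^bsub>free_boolean_ring \<nu>\<^esub> = {}"
  and add_free_boolean_ring: "p \<oplus>\<^bsub>free_boolean_ring \<nu>\<^esub> q = (p - q) \<union> (q - p)"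
  and mult_free_boolean_ring:
    "p \<otimes>\<^bsub>free_boolean_ring \<nu>\<^esub> q = {M. odd (card {(A, B). A \<in> p \<and> B \<in> q \<and> A \<union> B = M})}"
  by (simp_all add: free_boolean_ring_def)

lemmas free_boolean_ring_simps = carrier_free_boolean_ring one_free_boolean_ring
  zero_free_boolean_ring add_free_boolean_ring mult_free_boolean_ring

lemma finite_poly: "p \<in> carrier (free_boolean_ring \<nu>) \<Longrightarrow> finite p"
  by (rule finite_subset[of p "Pow {..<\<nu>}"]) (auto simp: carrier_free_boolean_ring)

lemma finite_monom: "p \<in> carrier (free_boolean_ring \<nu>) \<Longrightarrow> M \<in> p \<Longrightarrow> finite M"
  by (rule finite_subset[of M "{..<\<nu>}"]) (auto simp: carrier_free_boolean_ring)

lemma closed_free_boolean_ring: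
  assumes "p \<in> carrier (free_boolean_ring \<nu>)" "q \<in> carrier (free_boolean_ring \<nu>)"
  shows "p \<oplus>\<^bsub>free_boolean_ring \<nu>\<^esub> q \<in> carrier (free_boolean_ring \<nu>)"
    and "p \<otimes>\<^bsub>free_boolean_ring \<nu>\<^esub> q \<in> carrier (free_boolean_ring \<nu>)"
proof -
  show "p \<oplus>\<^bsub>free_boolean_ring \<nu>\<^esub> q \<in> carrier (free_boolean_ring \<nu>)"
    using assms by (auto simp: free_boolean_ring_simps)
  show "p \<otimes>\<^bsub>free_boolean_ring \<nu>\<^esub> q \<in> carrier (free_boolean_ring \<nu>)"
    unfolding carrier_free_boolean_ring
  proof
    show "p \<otimes>\<^bsub>free_boolean_ring \<nu>\<^esub> q \<subseteq> Pow {..<\<nu>}"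
    proof
      fix M assume "M \<in> p \<otimes>\<^bsub>free_boolean_ring \<nu>\<^esub> q"
      then have "{(A, B). A \<in> p \<and> B \<in> q \<and> A \<union> B = M} \<noteq> {}"
        by (metis (lifting) card.empty even_zero mem_Collect_eq mult_free_boolean_ring)
      then show "M \<in> Pow {..<\<nu>}"
        using assms by (auto simp: free_boolean_ring_simps)
    qed
  qed
qed

lemma boolean_char_2:
  assumes "\<And>a::'a::comm_ring_1. a * a = a"
  shows "(a::'a) + a = 0"
proof -
  have "(a + a) * (a + a) = (a * a + a * a) + (a * a + a * a)"
    by (simp only: distrib_left distrib_right)
  then show ?thesis
    unfolding assms by simp
qed

lemma boolean_of_nat:
  assumes "\<And>a::'a::comm_ring_1. a * a = a"
  shows "(of_nat n :: 'a) = of_bool (odd n)"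
  using boolean_char_2[OF assms, of "1::'a"] by (induction n) auto

lemma poly_ext_add:
  assumes B: "\<And>a::'a::comm_ring_1. a * a = a"
    and "p \<in> carrier (free_boolean_ring \<nu>)" "q \<in> carrier (free_boolean_ring \<nu>)"
  shows "poly_ext (f :: nat \<Rightarrow> 'a) (p \<oplus>\<^bsub>free_boolean_ring \<nu>\<^esub> q) = poly_ext f p + poly_ext f q"
proof -
  have f: "finite p" "finite q" using assms finite_poly by auto
  define g where "g M = (\<Prod>i\<in>M. f i)" for M
  have 1: "sum g p = sum g (p - q) + sum g (p \<inter> q)"
    using sum.Int_Diff[OF f(1), of g q] by (simp add: add.commute)
  have 2: "sum g q = sum g (q - p) + sum g (p \<inter> q)"
    using sum.Int_Diff[OF f(2), of g p] by (simp add: add.commute Int_commute)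
  have "sum g ((p - q) \<union> (q - p)) = sum g (p - q) + sum g (q - p)"
    using f by (intro sum.union_disjoint) auto
  also have "\<dots> = sum g (p - q) + sum g (q - p) + (sum g (p \<inter> q) + sum g (p \<inter> q))"
    by (simp add: boolean_char_2[OF B])
  also have "\<dots> = sum g p + sum g q"
    using 1 2 by (simp add: algebra_simps)
  finally show ?thesis
    by (simp add: poly_ext_def add_free_boolean_ring g_def)
qed

lemma boolean_prod_Un:
  assumes B: "\<And>a::'a::comm_ring_1. a * a = a" and "finite A" "finite C"
  shows "(\<Prod>i\<in>A \<union> C. f i :: 'a) = (\<Prod>i\<in>A. f i) * (\<Prod>i\<in>C. f i)"
  using assms(2)
proof (induction A rule: finite_induct)
  case (insert a A)
  show ?case
  proof (cases "a \<in> C")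
    case True
    have "f a * (\<Prod>i\<in>C. f i) = (f a * f a) * (\<Prod>i\<in>C - {a}. f i)"
      by (simp only: prod.remove[OF assms(3) True, of f] mult.assoc)
    also have "\<dots> = (\<Prod>i\<in>C. f i)"
      by (simp only: B prod.remove[OF assms(3) True, of f])
    finally have 1: "f a * (\<Prod>i\<in>C. f i) = (\<Prod>i\<in>C. f i)" .
    have "(\<Prod>i\<in>insert a A \<union> C. f i) = (\<Prod>i\<in>A. f i) * (f a * (\<Prod>i\<in>C. f i))"
      using insert True by (simp only: 1) (simp add: insert_absorb)
    also have "\<dots> = (\<Prod>i\<in>insert a A. f i) * (\<Prod>i\<in>C. f i)"
      using insert by (simp only: prod.insert ac_simps simp_thms)
    finally show ?thesis .
  next
    case False
    then show ?thesis using insert assms(3) by (simp add: mult.assoc)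
  qed
qed simp

lemma poly_ext_mult:
  assumes B: "\<And>a::'a::comm_ring_1. a * a = a"
    and p: "p \<in> carrier (free_boolean_ring \<nu>)" and q: "q \<in> carrier (free_boolean_ring \<nu>)"
  shows "poly_ext (f :: nat \<Rightarrow> 'a) (p \<otimes>\<^bsub>free_boolean_ring \<nu>\<^esub> q) = poly_ext f p * poly_ext f q"
proof -
  define g where "g M = (\<Prod>i\<in>M. f i)" for M
  let ?U = "Pow {..<\<nu>}"
  let ?c = "\<lambda>M. {(A, C). A \<in> p \<and> C \<in> q \<and> A \<union> C = M}"
  have f: "finite (p \<times> q)" using p q finite_poly by auto
  have sub: "p \<otimes>\<^bsub>free_boolean_ring \<nu>\<^esub> q \<subseteq> ?U"
    using closed_free_boolean_ring(2)[OF p q] by (simp add: carrier_free_boolean_ring)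
  have "poly_ext f p * poly_ext f q = (\<Sum>(A, C)\<in>p \<times> q. g A * g C)"
    by (simp add: poly_ext_def g_def sum_product sum.cartesian_product)
  also have "\<dots> = (\<Sum>z\<in>p \<times> q. g (fst z \<union> snd z))"
    by (intro sum.cong refl)
      (auto simp: g_def boolean_prod_Un[OF B] finite_monom[OF p] finite_monom[OF q])
  also have "\<dots> = (\<Sum>M\<in>?U. \<Sum>z\<in>{z \<in> p \<times> q. fst z \<union> snd z = M}. g (fst z \<union> snd z))"
    using f p q by (intro sum.group[symmetric]) (auto simp: carrier_free_boolean_ring, blast+)
  also have "\<dots> = (\<Sum>M\<in>?U. of_nat (card (?c M)) * g M)"
  proof (intro sum.cong refl)
    fix M
    have "{z \<in> p \<times> q. fst z \<union> snd z = M} = ?c M" by auto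
    moreover have "(\<Sum>z\<in>{z \<in> p \<times> q. fst z \<union> snd z = M}. g (fst z \<union> snd z))
      = (\<Sum>z\<in>{z \<in> p \<times> q. fst z \<union> snd z = M}. g M)"
      by (intro sum.cong) auto
    ultimately show "(\<Sum>z\<in>{z \<in> p \<times> q. fst z \<union> snd z = M}. g (fst z \<union> snd z))
      = of_nat (card (?c M)) * g M" by simp
  qed
  also have "\<dots> = (\<Sum>M\<in>?U. if M \<in> p \<otimes>\<^bsub>free_boolean_ring \<nu>\<^esub> q then g M else 0)"
    by (intro sum.cong refl) (simp add: boolean_of_nat[OF B] mult_free_boolean_ring)
  also have "\<dots> = sum g (p \<otimes>\<^bsub>free_boolean_ring \<nu>\<^esub> q)"
    using sub by (simp add: sum.inter_restrict[symmetric] Int_absorb1)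
  finally show ?thesis by (simp add: poly_ext_def g_def)
qed

lemma poly_ext_one: "poly_ext f \<one>\<^bsub>free_boolean_ring \<nu>\<^esub> = 1"
  and poly_ext_zero: "poly_ext f \<zero>\<^bsub>free_boolean_ring \<nu>\<^esub> = 0"
  and poly_ext_symb: "poly_ext f (symb i) = f i"
  by (simp_all add: poly_ext_def free_boolean_ring_simps symb_def)

lemma bit_idem: "(a::bit) * a = a"
  by (cases a) auto

lemmas inst_simps = poly_ext_add[OF bit_idem] poly_ext_mult[OF bit_idem]
  poly_ext_one poly_ext_zero poly_ext_symb

lemma free_boolean_ring_eqI:
  assumes p: "p \<in> carrier (free_boolean_ring \<nu>)" and q: "q \<in> carrier (free_boolean_ring \<nu>)"
    and eq: "\<And>\<Phi>::nat \<Rightarrow> bit. poly_ext \<Phi> p = poly_ext \<Phi> q"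
  shows "p = q"
proof (rule ccontr)
  let ?d = "p \<oplus>\<^bsub>free_boolean_ring \<nu>\<^esub> q"
  assume "p \<noteq> q"
  then have "?d \<noteq> {}" by (auto simp: add_free_boolean_ring)
  have d: "?d \<in> carrier (free_boolean_ring \<nu>)" using closed_free_boolean_ring p q by blast
  obtain M where M: "M \<in> ?d" "\<And>A. A \<in> ?d \<Longrightarrow> A \<subseteq> M \<Longrightarrow> M = A"
    using finite_has_minimal[OF finite_poly[OF d] \<open>?d \<noteq> {}\<close>] by metis
  define \<Phi> :: "nat \<Rightarrow> bit" where "\<Phi> i = of_bool (i \<in> M)" for i
  have "(\<Prod>i\<in>A. \<Phi> i) = (if A = M then 1 else 0)" if "A \<in> ?d" for A
  proof (cases "A \<subseteq> M")
    case True
    then have "A = M" using M that by auto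
    then show ?thesis by (simp add: \<Phi>_def)
  next
    case False
    then show ?thesis using finite_monom[OF d that] by (auto simp: \<Phi>_def)
  qed
  then have "poly_ext \<Phi> ?d = (\<Sum>A\<in>?d. if A = M then 1 else 0)"
    unfolding poly_ext_def by (intro sum.cong refl) auto
  also have "\<dots> = 1" using M finite_poly[OF d] by simp
  finally show False
    using eq[of \<Phi>] p q boolean_char_2[OF bit_idem, of "poly_ext \<Phi> q"] by (simp add: inst_simps)
qed

lemma cring_free_boolean_ring: "cring (free_boolean_ring \<nu>)"
proof -
  let ?R = "free_boolean_ring \<nu>"
  note cl = closed_free_boolean_ring and eqI = free_boolean_ring_eqI[where \<nu> = \<nu>]
  have c: "\<zero>\<^bsub>?R\<^esub> \<in> carrier ?R" "\<one>\<^bsub>?R\<^esub> \<in> carrier ?R"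
    by (auto simp: free_boolean_ring_simps)
  show ?thesis
  proof (intro cringI abelian_groupI comm_monoidI)
    fix p q r assume h: "p \<in> carrier ?R" "q \<in> carrier ?R" "r \<in> carrier ?R"
    show "p \<oplus>\<^bsub>?R\<^esub> q \<oplus>\<^bsub>?R\<^esub> r = p \<oplus>\<^bsub>?R\<^esub> (q \<oplus>\<^bsub>?R\<^esub> r)"
      by (rule eqI) (simp_all only: h cl inst_simps add.assoc)
    show "p \<otimes>\<^bsub>?R\<^esub> q \<otimes>\<^bsub>?R\<^esub> r = p \<otimes>\<^bsub>?R\<^esub> (q \<otimes>\<^bsub>?R\<^esub> r)"
      by (rule eqI) (simp_all only: h cl inst_simps mult.assoc)
    show "(p \<oplus>\<^bsub>?R\<^esub> q) \<otimes>\<^bsub>?R\<^esub> r = p \<otimes>\<^bsub>?R\<^esub> r \<oplus>\<^bsub>?R\<^esub> q \<otimes>\<^bsub>?R\<^esub> r"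
      by (rule eqI) (simp_all only: h cl inst_simps distrib_right)
  next
    fix p q assume h: "p \<in> carrier ?R" "q \<in> carrier ?R"
    show "p \<oplus>\<^bsub>?R\<^esub> q = q \<oplus>\<^bsub>?R\<^esub> p"
      by (auto simp: add_free_boolean_ring)
    show "p \<otimes>\<^bsub>?R\<^esub> q = q \<otimes>\<^bsub>?R\<^esub> p"
      by (rule eqI) (simp_all only: h cl inst_simps mult.commute)
  next
    fix p assume h: "p \<in> carrier ?R"
    show "\<zero>\<^bsub>?R\<^esub> \<oplus>\<^bsub>?R\<^esub> p = p"
      by (simp add: add_free_boolean_ring zero_free_boolean_ring)
    show "\<one>\<^bsub>?R\<^esub> \<otimes>\<^bsub>?R\<^esub> p = p"
      by (rule eqI) (use h c in \<open>simp_all add: cl inst_simps\<close>)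
    show "\<exists>q\<in>carrier ?R. q \<oplus>\<^bsub>?R\<^esub> p = \<zero>\<^bsub>?R\<^esub>"
      using h by (intro bexI[of _ p]) (simp_all add: add_free_boolean_ring zero_free_boolean_ring)
  qed (simp_all add: c cl)
qed

lemma idem_free_boolean_ring:
  assumes "p \<in> carrier (free_boolean_ring \<nu>)"
  shows "p \<otimes>\<^bsub>free_boolean_ring \<nu>\<^esub> p = p"
  using assms
  by (intro free_boolean_ring_eqI[where \<nu> = \<nu>])
    (simp_all add: closed_free_boolean_ring inst_simps bit_idem)

lemma symb_closed: "i < \<nu> \<Longrightarrow> symb i \<in> carrier (free_boolean_ring \<nu>)"
  by (auto simp: symb_def carrier_free_boolean_ring)

lemma free_boolean_ring_induct:
  assumes p: "p \<in> carrier (free_boolean_ring \<nu>)"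
    and zero: "P \<zero>\<^bsub>free_boolean_ring \<nu>\<^esub>" and one: "P \<one>\<^bsub>free_boolean_ring \<nu>\<^esub>"
    and symb: "\<And>i. i < \<nu> \<Longrightarrow> P (symb i)"
    and add: "\<And>p q. p \<in> carrier (free_boolean_ring \<nu>) \<Longrightarrow> q \<in> carrier (free_boolean_ring \<nu>) \<Longrightarrow>
      P p \<Longrightarrow> P q \<Longrightarrow> P (p \<oplus>\<^bsub>free_boolean_ring \<nu>\<^esub> q)"
    and mult: "\<And>p q. p \<in> carrier (free_boolean_ring \<nu>) \<Longrightarrow> q \<in> carrier (free_boolean_ring \<nu>) \<Longrightarrow>
      P p \<Longrightarrow> P q \<Longrightarrow> P (p \<otimes>\<^bsub>free_boolean_ring \<nu>\<^esub> q)"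
  shows "P p"
proof -
  have monom: "P {M}" if "M \<subseteq> {..<\<nu>}" for M
    using finite_subset[OF that finite_lessThan] that
  proof (induction M rule: finite_induct)
    case empty
    then show ?case using one by (simp add: one_free_boolean_ring)
  next
    case (insert i M)
    have "{insert i M} = symb i \<otimes>\<^bsub>free_boolean_ring \<nu>\<^esub> {M}"
    proof -
      have "{(A, B). A \<in> {{i}} \<and> B \<in> {M} \<and> A \<union> B = L} =
        (if L = insert i M then {({i}, M)} else {})" for L by auto
      then show ?thesis by (simp add: symb_def mult_free_boolean_ring)
    qed
    then show ?case
      using mult[of "symb i" "{M}"] insert symb[of i] symb_closed[of i \<nu>]
      by (simp add: carrier_free_boolean_ring)
  qed
  show ?thesis using finite_poly[OF p] p
  proof (induction p rule: finite_induct)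
    case empty
    then show ?case using zero by (simp add: zero_free_boolean_ring)
  next
    case (insert M p)
    have "insert M p = {M} \<oplus>\<^bsub>free_boolean_ring \<nu>\<^esub> p"
      using insert(2) by (auto simp: add_free_boolean_ring)
    moreover have "M \<subseteq> {..<\<nu>}" "p \<in> carrier (free_boolean_ring \<nu>)"
      using insert(4) by (auto simp: carrier_free_boolean_ring)
    ultimately show ?case
      using add[of "{M}" p] insert(3) monom[of M] by (simp add: carrier_free_boolean_ring)
  qed
qed

text \<open>Freeness: with the preceding homomorphism laws, \<^const>\<open>poly_ext\<close> is the only extension of a
  map on the symbols to a homomorphism into a Boolean ring.\<close>

lemma poly_ext_unique:
  fixes f :: "nat \<Rightarrow> 'a::comm_ring_1"
  assumes B: "\<And>a::'a. a * a = a"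
    and "h \<zero>\<^bsub>free_boolean_ring \<nu>\<^esub> = 0" and "h \<one>\<^bsub>free_boolean_ring \<nu>\<^esub> = 1"
    and "\<And>i. i < \<nu> \<Longrightarrow> h (symb i) = f i"
    and "\<And>p q. p \<in> carrier (free_boolean_ring \<nu>) \<Longrightarrow> q \<in> carrier (free_boolean_ring \<nu>) \<Longrightarrow>
      h (p \<oplus>\<^bsub>free_boolean_ring \<nu>\<^esub> q) = h p + h q"
    and "\<And>p q. p \<in> carrier (free_boolean_ring \<nu>) \<Longrightarrow> q \<in> carrier (free_boolean_ring \<nu>) \<Longrightarrow>
      h (p \<otimes>\<^bsub>free_boolean_ring \<nu>\<^esub> q) = h p * h q"
    and "p \<in> carrier (free_boolean_ring \<nu>)"
  shows "h p = poly_ext f p"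
  by (rule free_boolean_ring_induct[where P = "\<lambda>p. h p = poly_ext f p", OF assms(7)])
    (simp_all add: assms(2-6) poly_ext_add[OF B] poly_ext_mult[OF B] poly_ext_one poly_ext_zero
      poly_ext_symb)


section \<open>Generic integers\<close>

text \<open>A generic dyadic integer is represented by the function mapping an index to the component.\<close>

definition generic_dyadic :: "('a, 'b) ring_scheme \<Rightarrow> (nat \<Rightarrow> 'a) set" where
  "generic_dyadic R = {u. \<forall>i. u i \<in> carrier R}"

definition generic_rational :: "('a, 'b) ring_scheme \<Rightarrow> (nat \<Rightarrow> 'a) set" where
  "generic_rational R = {u \<in> generic_dyadic R. \<exists>n. \<forall>i\<ge>n. u i = u n}"

text \<open>For negative integers, \<^const>\<open>Bit_Operations.bit\<close> is the two's complement, that is, the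
  2-adic expansion.\<close>

definition generic_of_int :: "('a, 'b) ring_scheme \<Rightarrow> int \<Rightarrow> nat \<Rightarrow> 'a" where
  "generic_of_int R k i = (if Bit_Operations.bit k i then \<one>\<^bsub>R\<^esub> else \<zero>\<^bsub>R\<^esub>)"

definition shift :: "('a, 'b) ring_scheme \<Rightarrow> (nat \<Rightarrow> 'a) \<Rightarrow> nat \<Rightarrow> 'a" where
  "shift R u i = (case i of 0 \<Rightarrow> \<zero>\<^bsub>R\<^esub> | Suc n \<Rightarrow> u n)"

definition complement :: "('a, 'b) ring_scheme \<Rightarrow> (nat \<Rightarrow> 'a) \<Rightarrow> nat \<Rightarrow> 'a" where
  "complement R u i = \<one>\<^bsub>R\<^esub> \<oplus>\<^bsub>R\<^esub> u i"

definition scale :: "('a, 'b) ring_scheme \<Rightarrow> 'a \<Rightarrow> (nat \<Rightarrow> 'a) \<Rightarrow> nat \<Rightarrow> 'a" where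
  "scale R t u i = t \<otimes>\<^bsub>R\<^esub> u i"

definition component_wise_\<sigma>1 ::
  "('a, 'b) ring_scheme \<Rightarrow> (nat \<Rightarrow> 'a) \<Rightarrow> (nat \<Rightarrow> 'a) \<Rightarrow> (nat \<Rightarrow> 'a) \<Rightarrow> nat \<Rightarrow> 'a" where
  "component_wise_\<sigma>1 R u v w i = u i \<oplus>\<^bsub>R\<^esub> v i \<oplus>\<^bsub>R\<^esub> w i"

definition component_wise_\<sigma>2 ::
  "('a, 'b) ring_scheme \<Rightarrow> (nat \<Rightarrow> 'a) \<Rightarrow> (nat \<Rightarrow> 'a) \<Rightarrow> (nat \<Rightarrow> 'a) \<Rightarrow> nat \<Rightarrow> 'a" where
  "component_wise_\<sigma>2 R u v w i =
    (u i \<otimes>\<^bsub>R\<^esub> v i) \<oplus>\<^bsub>R\<^esub> (v i \<otimes>\<^bsub>R\<^esub> w i) \<oplus>\<^bsub>R\<^esub> (w i \<otimes>\<^bsub>R\<^esub> u i)"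

text \<open>An infinite product of which almost all factors are 1; on an infinite index set,
  \<^const>\<open>finprod\<close> would ignore all factors.\<close>

definition infinite_prod :: "('a, 'b) ring_scheme \<Rightarrow> (nat \<Rightarrow> 'a) \<Rightarrow> 'a" where
  "infinite_prod R f = finprod R f {i. f i \<noteq> \<one>\<^bsub>R\<^esub>}"


section \<open>Instantiations\<close>

abbreviation inst :: "(nat \<Rightarrow> bit) \<Rightarrow> nat set set \<Rightarrow> bit" where
  "inst \<Phi> \<equiv> poly_ext \<Phi>"

definition int_of_bits :: "(nat \<Rightarrow> bit) \<Rightarrow> int" where
  "int_of_bits b = (THE k. \<forall>i. Bit_Operations.bit k i \<longleftrightarrow> b i = 1)"

lemma ex1_int_of_bits:
  fixes b :: "nat \<Rightarrow> bit"
  assumes "\<forall>i\<ge>n. b i = a"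
  shows "\<exists>!k::int. \<forall>i. Bit_Operations.bit k i \<longleftrightarrow> b i = 1"
proof (rule ex_ex1I)
  show "\<exists>k::int. \<forall>i. Bit_Operations.bit k i \<longleftrightarrow> b i = 1"
    using assms
  proof (induction n arbitrary: b)
    case 0
    show ?case
    proof (cases "a = 1")
      case True
      then show ?thesis using 0 by (intro exI[of _ "-1"]) auto
    next
      case False
      then show ?thesis using 0 by (intro exI[of _ 0]) auto
    qed
  next
    case (Suc n)
    then have "\<forall>i\<ge>n. b (Suc i) = a" by simp
    then obtain k :: int where k: "\<forall>i. Bit_Operations.bit k i \<longleftrightarrow> b (Suc i) = 1"
      using Suc.IH[of "\<lambda>i. b (Suc i)"] by blast
    have "Bit_Operations.bit (of_bool (b 0 = 1) + 2 * k) i \<longleftrightarrow> b i = 1" for i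
      using k by (cases i) (auto simp: bit_0 bit_Suc)
    then show ?case by blast
  qed
qed (auto intro: bit_eqI)

definition inst_int :: "(nat \<Rightarrow> bit) \<Rightarrow> (nat \<Rightarrow> nat set set) \<Rightarrow> int" where
  "inst_int \<Phi> u = int_of_bits (\<lambda>i. inst \<Phi> (u i))"

lemma bit_inst_int:
  assumes "u \<in> generic_rational (free_boolean_ring \<nu>)"
  shows "Bit_Operations.bit (inst_int \<Phi> u) i \<longleftrightarrow> inst \<Phi> (u i) = 1"
proof -
  obtain n where "\<forall>i\<ge>n. u i = u n" using assms by (auto simp: generic_rational_def)
  then have "\<forall>i\<ge>n. inst \<Phi> (u i) = inst \<Phi> (u n)" by metis
  from theI'[OF ex1_int_of_bits[OF this]] show ?thesis
    unfolding inst_int_def int_of_bits_def by blast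
qed


section \<open>Length of a positive integer\<close>

definition int_length :: "int \<Rightarrow> nat" where
  "int_length a = Max {j. Bit_Operations.bit a j} + 1"

end

theory Submission
  imports Defs
begin

text \<open>
  Under an instantiation, the recursion is schoolbook division of \<^term>\<open>N\<close> by the odd integer
  \<open>X = \<Phi>(x)\<close> from the least significant bit upwards, with the running remainder kept in the
  borrow-save form \<open>C\<^sub>k - B\<^sub>k = N - X * Q\<^sub>k\<close>, where \<open>Q\<^sub>k < 2\<^sup>k\<close> collects the bits
  \<open>c\<^bsup>(i)\<^esup>\<^sub>i\<close>, \<open>i < k\<close>. Each step clears the lowest remaining bit, so that \<open>2\<^sup>k\<close> divides the
  remainder and \<open>Q\<^sub>k\<close> is the only candidate for a quotient below \<open>2\<^sup>k\<close>. The element \<open>e\<^sub>k\<close>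
  instantiates to 1 iff the remainder vanishes. Finally, a factor of length \<open>\<beta> - j\<close> has a
  cofactor below \<open>2\<^bsup>\<Gamma> + j\<^esup>\<close> because \<open>\<beta> + \<Gamma> = \<alpha> + 1\<close>.
\<close>

section \<open>Binary long division from the least significant bit\<close>

text \<open>Two half adders in sequence. Their carries are never both set at one position, so adding
  the carries is the same as XORing them, which gives the bitwise majority, the integer counterpart
  of \<sigma>2.\<close>

lemma full_adder:
  includes bit_operations_syntax
  fixes u v w :: int
  shows "u + v + w = (u XOR v XOR w) + 2 * ((u AND v) XOR (v AND w) XOR (w AND u))"
proof -
  have half: "a + b = (a XOR b) + 2 * (a AND b)" for a b :: int
  proof -
    have "(a XOR b) + (a AND b) = (a XOR b) OR (a AND b)"
      by (rule disjunctive_add_eq_or) (auto simp: Bit_Operations.bit_eq_iff bit_simps)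
    also have "\<dots> = a OR b"
      by (auto simp: Bit_Operations.bit_eq_iff bit_simps)
    finally show ?thesis using plus_and_or[of a b] by linarith
  qed
  have "(u AND v) + ((u XOR v) AND w) = (u AND v) XOR ((u XOR v) AND w)"
    by (rule disjunctive_add_eq_xor) (auto simp: Bit_Operations.bit_eq_iff bit_simps)
  also have "\<dots> = (u AND v) XOR (v AND w) XOR (w AND u)"
    by (auto simp: Bit_Operations.bit_eq_iff bit_simps)
  finally show ?thesis
    using half[of u v] half[of "u XOR v" w] by (simp add: xor.assoc)
qed

text \<open>Since NOT u = -u - 1, subtracting from u amounts to adding to NOT u and complementing
  the result. This is why the borrow recursion applies \<sigma>2 to the complement of c.\<close>

lemma full_subtractor:
  includes bit_operations_syntax
  fixes u v w :: int
  shows "u - v - w = (u XOR v XOR w) - 2 * ((NOT u AND v) XOR (v AND w) XOR (w AND NOT u))"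
proof -
  have "(NOT u XOR v XOR w) = NOT (u XOR v XOR w)"
    by (simp add: Bit_Operations.bit_eq_iff bit_simps)
  then show ?thesis
    using full_adder[of "NOT u" v w] by (simp add: not_int_def)
qed

lemma dvd_power_two_iff_low_bits:
  fixes a :: int
  shows "2 ^ n dvd a \<longleftrightarrow> (\<forall>i<n. \<not> Bit_Operations.bit a i)"
proof -
  have "2 ^ n dvd a \<longleftrightarrow> take_bit n a = 0"
    by (simp add: take_bit_eq_mod dvd_eq_mod_eq_0)
  also have "\<dots> \<longleftrightarrow> (\<forall>i<n. \<not> Bit_Operations.bit a i)"
    by (subst Bit_Operations.bit_eq_iff) (auto simp: bit_take_bit_iff)
  finally show ?thesis .
qed

text \<open>The integer shadow of the recursion. The assumptions are bitwise because an
  instantiation delivers them component by component; the \<open>case\<close> in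
  \<open>bit_B_Suc\<close> is the left shift.\<close>

locale binary_division =
  fixes N X :: int and C B :: "nat \<Rightarrow> int"
  assumes odd_X: "odd X"
    and C_0: "C 0 = N" and B_0: "B 0 = 0"
    and bit_C_Suc: "\<And>k i. Bit_Operations.bit (C (Suc k)) i \<longleftrightarrow>
      ((Bit_Operations.bit (C k) i \<noteq> Bit_Operations.bit (B k) i) \<noteq>
        (Bit_Operations.bit (C k) k \<and> Bit_Operations.bit (push_bit k X) i))"
    and bit_B_Suc: "\<And>k i. Bit_Operations.bit (B (Suc k)) i \<longleftrightarrow> (case i of 0 \<Rightarrow> False | Suc m \<Rightarrow>
      ((\<not> Bit_Operations.bit (C k) m \<and> Bit_Operations.bit (B k) m) \<noteq>
        (Bit_Operations.bit (B k) m \<and> Bit_Operations.bit (C k) k \<and> Bit_Operations.bit (push_bit k X) m)) \<noteq>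
        (Bit_Operations.bit (C k) k \<and> Bit_Operations.bit (push_bit k X) m \<and> \<not> Bit_Operations.bit (C k) m))"
begin

definition quotient :: "nat \<Rightarrow> int" where
  "quotient k = (\<Sum>m<k. of_bool (Bit_Operations.bit (C m) m) * 2 ^ m)"

lemma quotient_nonneg: "0 \<le> quotient k"
  by (simp add: quotient_def sum_nonneg)

lemma quotient_0: "quotient 0 = 0"
  and quotient_Suc: "quotient (Suc k) = quotient k + of_bool (Bit_Operations.bit (C k) k) * 2 ^ k"
  unfolding quotient_def by simp_all

lemma quotient_less: "quotient k < 2 ^ k"
proof (induction k)
  case (Suc k)
  have "quotient (Suc k) \<le> quotient k + 2 ^ k" by (simp add: quotient_Suc)
  with Suc show ?case by simp
qed (simp add: quotient_0)

text \<open>No carry ever occurs: the summand added at stage k has at most bit k, while all bits of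
  \<open>quotient k\<close> lie below k, so the sum is an OR.\<close>

lemma bit_quotient:
  "Bit_Operations.bit (quotient k) i \<longleftrightarrow> i < k \<and> Bit_Operations.bit (C i) i"
proof (induction k arbitrary: i)
  case (Suc k)
  define b :: int where "b = (if Bit_Operations.bit (C k) k then 2 ^ k else 0)"
  have bit_b: "Bit_Operations.bit b i \<longleftrightarrow> i = k \<and> Bit_Operations.bit (C k) k" for i
    by (auto simp: b_def bit_exp_iff)
  have "quotient (Suc k) = quotient k + b"
    by (simp add: quotient_Suc b_def)
  also have "\<dots> = Bit_Operations.or (quotient k) b"
    by (rule disjunctive_add_eq_or, rule bit_eqI)
      (auto simp: bit_and_iff Suc bit_b)
  finally show ?case
    by (simp only: bit_or_iff Suc bit_b less_Suc_eq) blast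
qed (simp add: quotient_0)

lemma difference_Suc:
  "C (Suc k) - B (Suc k) = C k - B k - of_bool (Bit_Operations.bit (C k) k) * (2 ^ k * X)"
proof -
  include bit_operations_syntax
  \<comment> \<open>\<open>W\<close> is the integer counterpart of the scaled shift of x, so one
    step of the recursion is exactly one full subtractor.\<close>
  define W where "W = (if Bit_Operations.bit (C k) k then push_bit k X else 0)"
  have "C (Suc k) = (C k XOR B k XOR W)"
    by (rule bit_eqI) (auto simp: bit_xor_iff bit_C_Suc W_def)
  moreover have "B (Suc k) = 2 * ((NOT (C k) AND B k) XOR (B k AND W) XOR (W AND NOT (C k)))"
    by (rule bit_eqI, subst bit_B_Suc, subst bit_double_iff)
      (auto simp: bit_xor_iff bit_and_iff bit_not_iff W_def split: nat.split)
  moreover have "W = of_bool (Bit_Operations.bit (C k) k) * (2 ^ k * X)"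
    by (simp add: W_def push_bit_eq_mult mult.commute)
  ultimately show ?thesis
    using full_subtractor[of "C k" "B k" W] by simp
qed

lemma difference: "C k - B k = N - X * quotient k"
proof (induction k)
  case (Suc k)
  then show ?case
    by (simp add: difference_Suc quotient_Suc algebra_simps)
qed (simp add: C_0 B_0 quotient_0)

text \<open>The borrow into position \<^term>\<open>k\<close> vanishes, so that bit \<^term>\<open>k\<close> of \<^term>\<open>C k\<close> is
  already the correct next digit of the quotient.\<close>

lemma low_bits:
  "(\<forall>i<k. \<not> Bit_Operations.bit (C k) i) \<and> (\<forall>i\<le>k. \<not> Bit_Operations.bit (B k) i)"
proof (induction k)
  case 0
  then show ?case by (simp add: B_0)
next
  case (Suc k)
  \<comment> \<open>Because X is odd, the subtrahend has at position k the same bit as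
    \<open>C k\<close>. That bit therefore cancels, and a borrow out of position k would need it
    both set and clear.\<close>
  have "Bit_Operations.bit (push_bit k X) k"
    using odd_X by (simp add: bit_simps bit_0)
  moreover have "\<not> Bit_Operations.bit (push_bit k X) i" if "i < k" for i
    using that by (simp add: bit_simps)
  ultimately show ?case
    using Suc by (auto simp: bit_C_Suc bit_B_Suc less_Suc_eq le_Suc_eq split: nat.split)
qed

lemma power_two_dvd_remainder: "2 ^ k dvd N - X * quotient k"
  unfolding difference[symmetric] using low_bits[of k]
  by (intro dvd_diff) (auto simp: dvd_power_two_iff_low_bits)

lemma C_eq_B_iff: "C k = B k \<longleftrightarrow> N = X * quotient k"
  using difference[of k] by auto

text \<open>An odd X is invertible modulo 2^k, so q and \<open>quotient k\<close> are congruent;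
  both lie in [0, 2^k), hence they are equal.\<close>

lemma quotient_eq:
  assumes "N = X * q" "0 \<le> q" "q < 2 ^ k"
  shows "quotient k = q"
proof -
  have "2 ^ k dvd X * (q - quotient k)"
    using power_two_dvd_remainder[of k] assms(1) by (simp add: right_diff_distrib)
  moreover have "coprime (2 ^ k) X"
    using odd_X by simp
  ultimately have "2 ^ k dvd q - quotient k"
    by (simp add: coprime_dvd_mult_right_iff)
  then have "q mod 2 ^ k = quotient k mod 2 ^ k"
    by (simp add: mod_eq_dvd_iff)
  then show ?thesis
    using assms quotient_nonneg quotient_less by simp
qed

end


section \<open>Bit length\<close>

text \<open>Makes the \<open>Max\<close> in \<open>int_length\<close> meaningful and bounds the
  support of the expansion of N. The crude bound a < 2^a suffices.\<close>

lemma finite_bits_nonneg: "0 \<le> (a::int) \<Longrightarrow> finite {j. Bit_Operations.bit a j}"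
proof -
  assume a: "0 \<le> a"
  have "a < 2 ^ nat a"
    using a of_nat_less_two_power[of "nat a", where 'a = int] by simp
  then have "take_bit (nat a) a = a"
    using a by (simp add: take_bit_int_eq_self)
  then have "{j. Bit_Operations.bit a j} \<subseteq> {..<nat a}"
    by (metis (no_types, lifting) bit_take_bit_iff lessThan_iff mem_Collect_eq subsetI)
  then show ?thesis by (rule finite_subset) simp
qed

lemma int_length_eq_Suc_iff:
  assumes "0 < a"
  shows "int_length a = Suc n \<longleftrightarrow> Bit_Operations.bit a n \<and> (\<forall>i>n. \<not> Bit_Operations.bit a i)"
proof -
  let ?S = "{j. Bit_Operations.bit a j}"
  have fin: "finite ?S" using assms by (simp add: finite_bits_nonneg)
  have "?S \<noteq> {}"
  proof
    assume "?S = {}"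
    then have "a = 0" by (intro bit_eqI) auto
    then show False using assms by simp
  qed
  then have "Max ?S = n \<longleftrightarrow> n \<in> ?S \<and> (\<forall>i\<in>?S. i \<le> n)"
    using fin by (rule Max_eq_iff[rotated])
  then show ?thesis by (auto simp: int_length_def not_less[symmetric])
qed

lemma int_length_bounds:
  assumes "0 < a"
  shows "2 ^ (int_length a - 1) \<le> a" and "a < 2 ^ int_length a"
proof -
  \<comment> \<open>\<open>int_length\<close> is \<open>Max\<close> plus 1, hence never 0, and n is
    the position of the top bit.\<close>
  obtain n where n: "int_length a = Suc n" by (simp add: int_length_def)
  then have bits: "Bit_Operations.bit a n" "\<forall>i>n. \<not> Bit_Operations.bit a i"
    using assms by (simp_all add: int_length_eq_Suc_iff)
  have "take_bit (Suc n) a = a"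
    using bits(2) by (intro bit_eqI) (auto simp: bit_take_bit_iff less_Suc_eq_le not_less[symmetric])
  then show "a < 2 ^ int_length a"
    using take_bit_int_less_exp[of "Suc n" a] n by simp
  have "\<not> a < 2 ^ n"
  proof
    assume "a < 2 ^ n"
    then have "take_bit n a = a" using assms by (simp add: take_bit_int_eq_self)
    then show False using bits(1) by (metis bit_take_bit_iff less_irrefl)
  qed
  then show "2 ^ (int_length a - 1) \<le> a" using n by simp
qed


section \<open>Instantiated generic division\<close>

text \<open>Stronger than eventually constant: the tail must be zero. This is the invariant that
  makes almost all factors of e_k equal to 1.\<close>

definition generic_finite :: "('a, 'b) ring_scheme \<Rightarrow> (nat \<Rightarrow> 'a) set" where
  "generic_finite R = {u \<in> generic_dyadic R. \<exists>n. \<forall>i\<ge>n. u i = \<zero>\<^bsub>R\<^esub>}"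

lemma generic_finite_subset_rational: "generic_finite R \<subseteq> generic_rational R"
proof
  fix u assume "u \<in> generic_finite R"
  then obtain n where "u \<in> generic_dyadic R" "\<forall>i\<ge>n. u i = \<zero>\<^bsub>R\<^esub>"
    by (auto simp: generic_finite_def)
  then show "u \<in> generic_rational R"
    by (auto simp: generic_rational_def intro!: exI[of _ n])
qed

lemma generic_finiteI:
  assumes "\<And>i. u i \<in> carrier R" "\<And>i. n \<le> i \<Longrightarrow> u i = \<zero>\<^bsub>R\<^esub>"
  shows "u \<in> generic_finite R"
  using assms by (auto simp: generic_finite_def generic_dyadic_def)

lemma generic_finite_closed: "u \<in> generic_finite R \<Longrightarrow> u i \<in> carrier R"
  by (simp add: generic_finite_def generic_dyadic_def)

lemma generic_finite_bound:
  assumes "u \<in> generic_finite R"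
  obtains n where "\<And>i. n \<le> i \<Longrightarrow> u i = \<zero>\<^bsub>R\<^esub>"
  using assms by (auto simp: generic_finite_def)

section \<open>Closure of finitely supported generic integers under the operations of the
  recursion\<close>

context cring
begin

lemma generic_finite_of_int:
  assumes "0 \<le> k"
  shows "generic_of_int R k \<in> generic_finite R"
proof -
  obtain n where "\<forall>j\<in>{j. Bit_Operations.bit k j}. j < n"
    using finite_bits_nonneg[OF assms] unfolding finite_nat_set_iff_bounded by blast
  then show ?thesis
    by (intro generic_finiteI[where n = n]) (auto simp: generic_of_int_def)
qed

lemma generic_finite_shift:
  assumes "u \<in> generic_finite R"
  shows "shift R u \<in> generic_finite R"
proof -
  obtain n where "\<And>i. n \<le> i \<Longrightarrow> u i = \<zero>" using generic_finite_bound[OF assms] by metis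
  then show ?thesis using generic_finite_closed[OF assms]
    by (intro generic_finiteI[where n = "Suc n"]) (auto simp: shift_def split: nat.split)
qed

lemma generic_finite_shift_funpow:
  "u \<in> generic_finite R \<Longrightarrow> (shift R ^^ k) u \<in> generic_finite R"
  by (induction k) (simp_all add: generic_finite_shift)

lemma generic_finite_scale:
  assumes "t \<in> carrier R" "u \<in> generic_finite R"
  shows "scale R t u \<in> generic_finite R"
proof -
  obtain n where "\<And>i. n \<le> i \<Longrightarrow> u i = \<zero>" using generic_finite_bound[OF assms(2)] by metis
  then show ?thesis using assms(1) generic_finite_closed[OF assms(2)]
    by (intro generic_finiteI[where n = n]) (auto simp: scale_def)
qed

lemma generic_finite_\<sigma>1:
  assumes "u \<in> generic_finite R" "v \<in> generic_finite R" "w \<in> generic_finite R"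
  shows "component_wise_\<sigma>1 R u v w \<in> generic_finite R"
proof -
  obtain l m n where "\<And>i. l \<le> i \<Longrightarrow> u i = \<zero>" "\<And>i. m \<le> i \<Longrightarrow> v i = \<zero>" "\<And>i. n \<le> i \<Longrightarrow> w i = \<zero>"
    using assms[THEN generic_finite_bound] by metis
  then show ?thesis using assms[THEN generic_finite_closed]
    by (intro generic_finiteI[where n = "l + m + n"]) (auto simp: component_wise_\<sigma>1_def)
qed

text \<open>Each of the three products contains v or w, so the tail vanishes whatever u is. The
  first argument must be this general because the complement of c has a tail of ones.\<close>

lemma generic_finite_\<sigma>2:
  assumes "u \<in> generic_dyadic R" "v \<in> generic_finite R" "w \<in> generic_finite R"
  shows "component_wise_\<sigma>2 R u v w \<in> generic_finite R"
proof -
  obtain m n where "\<And>i. m \<le> i \<Longrightarrow> v i = \<zero>" "\<And>i. n \<le> i \<Longrightarrow> w i = \<zero>"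
    using assms(2,3)[THEN generic_finite_bound] by metis
  then show ?thesis using assms(1) assms(2,3)[THEN generic_finite_closed]
    by (intro generic_finiteI[where n = "m + n"])
      (auto simp: component_wise_\<sigma>2_def generic_dyadic_def)
qed

lemma complement_dyadic: "u \<in> generic_dyadic R \<Longrightarrow> complement R u \<in> generic_dyadic R"
  by (simp add: complement_def generic_dyadic_def)

lemma shift_funpow: "(shift R ^^ k) u i = (if i < k then \<zero> else u (i - k))"
proof (induction k arbitrary: i)
  case (Suc k)
  then show ?case by (cases i) (auto simp: shift_def)
qed simp

end

section \<open>Instantiating sums and products\<close>

lemma bit_add_eq_1_iff: "(a::bit) + b = 1 \<longleftrightarrow> (a = 1) \<noteq> (b = 1)"
  and bit_mult_eq_1_iff: "(a::bit) * b = 1 \<longleftrightarrow> a = 1 \<and> b = 1"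
  by (cases a; cases b; simp)+

lemma inst_finprod:
  assumes "finite A" "\<And>i. i \<in> A \<Longrightarrow> f i \<in> carrier (free_boolean_ring \<nu>)"
  shows "inst \<Phi> (finprod (free_boolean_ring \<nu>) f A) = (\<Prod>i\<in>A. inst \<Phi> (f i))"
proof -
  interpret cring "free_boolean_ring \<nu>" by (rule cring_free_boolean_ring)
  show ?thesis
    using assms by (induction A rule: finite_induct) (simp_all add: inst_simps Pi_def del: mult_bit_eq_and)
qed

lemma inst_infinite_prod_eq_1_iff:
  assumes "\<And>i. f i \<in> carrier (free_boolean_ring \<nu>)"
    and "\<And>i. n \<le> i \<Longrightarrow> f i = \<one>\<^bsub>free_boolean_ring \<nu>\<^esub>"
  shows "inst \<Phi> (infinite_prod (free_boolean_ring \<nu>) f) = 1 \<longleftrightarrow> (\<forall>i. inst \<Phi> (f i) = 1)"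
proof -
  let ?A = "{i. f i \<noteq> \<one>\<^bsub>free_boolean_ring \<nu>\<^esub>}"
  \<comment> \<open>Finiteness keeps \<open>finprod\<close> from its default value on infinite index
    sets. A product in F_2 is 1 iff every factor is, and factors outside \<open>?A\<close> are 1
    anyway.\<close>
  have "?A \<subseteq> {..<n}" using assms(2) by (auto simp: not_le[symmetric])
  then have fin: "finite ?A" by (rule finite_subset) simp
  have "inst \<Phi> (infinite_prod (free_boolean_ring \<nu>) f) = (\<Prod>i\<in>?A. inst \<Phi> (f i))"
    unfolding infinite_prod_def using fin assms(1) by (rule inst_finprod)
  moreover have "(\<Prod>i\<in>?A. inst \<Phi> (f i)) = 1 \<longleftrightarrow> (\<forall>i\<in>?A. inst \<Phi> (f i) = 1)"
    using fin by (induction rule: finite_induct) auto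
  moreover have "inst \<Phi> (f i) = 1" if "f i = \<one>\<^bsub>free_boolean_ring \<nu>\<^esub>" for i
    by (simp only: that poly_ext_one)
  ultimately show ?thesis by (metis (mono_tags, lifting) mem_Collect_eq)
qed

text \<open>The symbolic recursion for any finitely supported odd x; the concrete symbols of x enter
  only in the final theorem.\<close>

locale generic_division =
  fixes \<nu> :: nat and R :: "nat set set ring" and N :: int
    and x :: "nat \<Rightarrow> nat set set" and c borrows :: "nat \<Rightarrow> nat \<Rightarrow> nat set set"
  assumes R_eq: "R = free_boolean_ring \<nu>"
    and N_nonneg: "0 \<le> N"
    and x_finite: "x \<in> generic_finite R" and x_odd: "x 0 = \<one>\<^bsub>R\<^esub>"
    and c_0: "c 0 = generic_of_int R N"
    and borrows_0: "borrows 0 = generic_of_int R 0"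
    and c_Suc: "\<And>i. c (Suc i) =
      component_wise_\<sigma>1 R (c i) (borrows i) (scale R (c i i) ((shift R ^^ i) x))"
    and borrows_Suc: "\<And>i. borrows (Suc i) =
      shift R (component_wise_\<sigma>2 R (complement R (c i)) (borrows i)
        (scale R (c i i) ((shift R ^^ i) x)))"
begin

sublocale cring R
  unfolding R_eq by (rule cring_free_boolean_ring)

lemma c_borrows_finite: "c k \<in> generic_finite R \<and> borrows k \<in> generic_finite R"
proof (induction k)
  case 0
  then show ?case by (simp add: c_0 borrows_0 N_nonneg generic_finite_of_int)
next
  case (Suc k)
  then have "scale R (c k k) ((shift R ^^ k) x) \<in> generic_finite R"
    by (simp add: generic_finite_scale generic_finite_shift_funpow generic_finite_closed x_finite)
  moreover have "complement R (c k) \<in> generic_dyadic R"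
    using Suc by (intro complement_dyadic) (simp add: generic_finite_def)
  ultimately show ?case
    using Suc by (simp add: c_Suc borrows_Suc generic_finite_\<sigma>1 generic_finite_\<sigma>2 generic_finite_shift)
qed

lemmas c_closed = generic_finite_closed[OF conjunct1[OF c_borrows_finite]]
  and borrows_closed = generic_finite_closed[OF conjunct2[OF c_borrows_finite]]

lemma bit_inst_finite:
  "u \<in> generic_finite R \<Longrightarrow> Bit_Operations.bit (inst_int \<Phi> u) i \<longleftrightarrow> inst \<Phi> (u i) = 1"
  using bit_inst_int generic_finite_subset_rational unfolding R_eq by blast

lemmas bit_inst_c = bit_inst_finite[OF conjunct1[OF c_borrows_finite]]
  and bit_inst_borrows = bit_inst_finite[OF conjunct2[OF c_borrows_finite]]
  and bit_inst_x = bit_inst_finite[OF x_finite]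

lemma inst_R:
  "p \<in> carrier R \<Longrightarrow> q \<in> carrier R \<Longrightarrow> inst \<Phi> (p \<oplus>\<^bsub>R\<^esub> q) = inst \<Phi> p + inst \<Phi> q"
  "p \<in> carrier R \<Longrightarrow> q \<in> carrier R \<Longrightarrow> inst \<Phi> (p \<otimes>\<^bsub>R\<^esub> q) = inst \<Phi> p * inst \<Phi> q"
  "inst \<Phi> \<one>\<^bsub>R\<^esub> = 1" "inst \<Phi> \<zero>\<^bsub>R\<^esub> = 0"
  unfolding R_eq by (simp_all only: inst_simps)

lemma inst_shifted_x:
  "inst \<Phi> ((shift R ^^ k) x i) = 1 \<longleftrightarrow> Bit_Operations.bit (push_bit k (inst_int \<Phi> x)) i"
  by (auto simp: shift_funpow inst_R bit_push_bit_iff bit_inst_x)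

text \<open>The bridge to integer arithmetic: instantiation commutes with the ring operations, and
  an equation over F_2 becomes one between truth values, with addition read as inequality.\<close>

lemma binary_division_inst:
  "binary_division N (inst_int \<Phi> x) (\<lambda>k. inst_int \<Phi> (c k)) (\<lambda>k. inst_int \<Phi> (borrows k))"
proof
  show "odd (inst_int \<Phi> x)"
    using bit_inst_x[of \<Phi> 0] by (simp add: bit_0 x_odd inst_R)
  show "inst_int \<Phi> (c 0) = N"
    by (rule bit_eqI, subst bit_inst_c) (simp add: c_0 generic_of_int_def inst_R)
  show "inst_int \<Phi> (borrows 0) = 0"
    by (rule bit_eqI, subst bit_inst_borrows) (simp add: borrows_0 generic_of_int_def inst_R)
  fix k i
  have x: "(shift R ^^ k) x i \<in> carrier R" for i
    by (simp add: generic_finite_closed generic_finite_shift_funpow x_finite)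
  show "Bit_Operations.bit (inst_int \<Phi> (c (Suc k))) i \<longleftrightarrow>
      ((Bit_Operations.bit (inst_int \<Phi> (c k)) i \<noteq> Bit_Operations.bit (inst_int \<Phi> (borrows k)) i) \<noteq>
        (Bit_Operations.bit (inst_int \<Phi> (c k)) k \<and> Bit_Operations.bit (push_bit k (inst_int \<Phi> x)) i))"
    \<comment> \<open>The deleted simp rules would turn sums and products of bits into XOR and AND
      before the truth-value rules could match.\<close>
    unfolding bit_inst_c bit_inst_borrows inst_shifted_x[symmetric]
    by (simp add: c_Suc component_wise_\<sigma>1_def scale_def inst_R x c_closed borrows_closed
        bit_add_eq_1_iff bit_mult_eq_1_iff del: add_bit_eq_xor mult_bit_eq_and)
  show "Bit_Operations.bit (inst_int \<Phi> (borrows (Suc k))) i \<longleftrightarrow> (case i of 0 \<Rightarrow> False | Suc m \<Rightarrow>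
      ((\<not> Bit_Operations.bit (inst_int \<Phi> (c k)) m \<and> Bit_Operations.bit (inst_int \<Phi> (borrows k)) m) \<noteq>
        (Bit_Operations.bit (inst_int \<Phi> (borrows k)) m \<and> Bit_Operations.bit (inst_int \<Phi> (c k)) k \<and>
          Bit_Operations.bit (push_bit k (inst_int \<Phi> x)) m)) \<noteq>
        (Bit_Operations.bit (inst_int \<Phi> (c k)) k \<and> Bit_Operations.bit (push_bit k (inst_int \<Phi> x)) m \<and>
          \<not> Bit_Operations.bit (inst_int \<Phi> (c k)) m))"
    unfolding bit_inst_c bit_inst_borrows inst_shifted_x[symmetric]
    by (auto simp: borrows_Suc shift_def component_wise_\<sigma>2_def complement_def scale_def inst_R x
        c_closed borrows_closed bit_add_eq_1_iff bit_mult_eq_1_iff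
        simp del: add_bit_eq_xor mult_bit_eq_and split: nat.split)
qed

text \<open>A factor of e_k instantiates to 1 iff the components of c and borrows agree there, so
  e_k tests whether c minus borrows, the remainder, vanishes.\<close>

lemma inst_e_eq_1_iff:
  "inst \<Phi> (infinite_prod R (\<lambda>i. c k i \<oplus>\<^bsub>R\<^esub> borrows k i \<oplus>\<^bsub>R\<^esub> \<one>\<^bsub>R\<^esub>)) = 1 \<longleftrightarrow>
    inst_int \<Phi> (c k) = inst_int \<Phi> (borrows k)"
proof -
  obtain m n where mn: "\<And>i. m \<le> i \<Longrightarrow> c k i = \<zero>\<^bsub>R\<^esub>" "\<And>i. n \<le> i \<Longrightarrow> borrows k i = \<zero>\<^bsub>R\<^esub>"
    using c_borrows_finite[of k] generic_finite_bound by metis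
  have "inst \<Phi> (infinite_prod R (\<lambda>i. c k i \<oplus>\<^bsub>R\<^esub> borrows k i \<oplus>\<^bsub>R\<^esub> \<one>\<^bsub>R\<^esub>)) = 1 \<longleftrightarrow>
      (\<forall>i. inst \<Phi> (c k i \<oplus>\<^bsub>R\<^esub> borrows k i \<oplus>\<^bsub>R\<^esub> \<one>\<^bsub>R\<^esub>) = 1)"
    using mn c_closed borrows_closed unfolding R_eq
    by (intro inst_infinite_prod_eq_1_iff[where n = "m + n"])
      (simp_all flip: R_eq)
  also have "\<dots> \<longleftrightarrow> (\<forall>i. inst \<Phi> (c k i) = 1 \<longleftrightarrow> inst \<Phi> (borrows k i) = 1)"
    by (simp only: inst_R c_closed borrows_closed a_closed one_closed bit_add_eq_1_iff) simp
  also have "\<dots> \<longleftrightarrow> inst_int \<Phi> (c k) = inst_int \<Phi> (borrows k)"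
    unfolding bit_inst_c[symmetric] bit_inst_borrows[symmetric] by (auto intro: bit_eqI)
  finally show ?thesis .
qed

text \<open>Identifies the cofactor formula of the theorem with the quotient after k division steps,
  via \<open>bit_quotient\<close>.\<close>

lemma inst_diagonal:
  "inst_int \<Phi> (\<lambda>i. if i < k then c i i else \<zero>\<^bsub>R\<^esub>) =
    binary_division.quotient (\<lambda>k. inst_int \<Phi> (c k)) k"
proof -
  interpret binary_division N "inst_int \<Phi> x" "\<lambda>k. inst_int \<Phi> (c k)" "\<lambda>k. inst_int \<Phi> (borrows k)"
    by (rule binary_division_inst)
  have "(\<lambda>i. if i < k then c i i else \<zero>\<^bsub>R\<^esub>) \<in> generic_finite R"
    using c_closed by (intro generic_finiteI[where n = k]) auto
  then show ?thesis
    by (intro bit_eqI) (auto simp: bit_inst_finite bit_quotient bit_inst_c inst_R)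
qed

end

section \<open>Factors of prescribed length\<close>

theorem theorem2:
  fixes N :: int and \<nu> \<alpha> \<beta> \<Gamma> j :: nat
    and R :: "nat set set ring"
    and x :: "nat \<Rightarrow> nat set set"
    and c borrows :: "nat \<Rightarrow> nat \<Rightarrow> nat set set"
    and e :: "nat \<Rightarrow> nat set set"
  assumes "N > 0"
    and "\<alpha> = int_length N"
    and "\<beta> = nat \<lfloor>(1 + real \<alpha>) / 2\<rfloor>"
    and "\<Gamma> = nat \<lceil>(1 + real \<alpha>) / 2\<rceil>"
    and "\<nu> \<ge> \<beta>"
    and "R = free_boolean_ring \<nu>"
    and "x = (\<lambda>i. if i = 0 then \<one>\<^bsub>R\<^esub> else if i < \<beta> then symb i else \<zero>\<^bsub>R\<^esub>)"
    and "c 0 = generic_of_int R N"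
    and "borrows 0 = generic_of_int R 0"
    and "\<And>i. c (Suc i) =
      component_wise_\<sigma>1 R (c i) (borrows i) (scale R (c i i) ((shift R ^^ i) x))"
    and "\<And>i. borrows (Suc i) =
      shift R (component_wise_\<sigma>2 R (complement R (c i)) (borrows i)
        (scale R (c i i) ((shift R ^^ i) x)))"
    and "\<And>k. e k = infinite_prod R (\<lambda>i. c k i \<oplus>\<^bsub>R\<^esub> borrows k i \<oplus>\<^bsub>R\<^esub> \<one>\<^bsub>R\<^esub>)"
    and "j \<le> \<beta> - 1"
  shows "((\<exists>d::int. d > 0 \<and> odd d \<and> d dvd N \<and> int_length d = \<beta> - j) \<longleftrightarrow>
      (\<exists>\<Phi>. (\<forall>p\<in>{1..j}. \<Phi> (\<beta> - p) = 0) \<and> \<Phi> (\<beta> - (j + 1)) = 1 \<and> inst \<Phi> (e (\<Gamma> + j)) = 1)) \<and>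
    (\<forall>\<Phi>. (\<forall>p\<in>{1..j}. \<Phi> (\<beta> - p) = 0) \<and> \<Phi> (\<beta> - (j + 1)) = 1 \<and> inst \<Phi> (e (\<Gamma> + j)) = 1 \<longrightarrow>
      inst_int \<Phi> x > 0 \<and>
      inst_int \<Phi> (\<lambda>i. if i < \<Gamma> + j then c i i else \<zero>\<^bsub>R\<^esub>) > 0 \<and>
      N = inst_int \<Phi> x * inst_int \<Phi> (\<lambda>i. if i < \<Gamma> + j then c i i else \<zero>\<^bsub>R\<^esub>) \<and>
      N div inst_int \<Phi> x = inst_int \<Phi> (\<lambda>i. if i < \<Gamma> + j then c i i else \<zero>\<^bsub>R\<^esub>))"
proof -
  have \<alpha>: "\<alpha> \<ge> 1" using assms(2) by (simp add: int_length_def)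
  have \<beta>: "\<beta> = (1 + \<alpha>) div 2"
  proof -
    have "\<lfloor>(1 + real \<alpha>) / 2\<rfloor> = int ((1 + \<alpha>) div 2)"
      using floor_divide_of_nat_eq[of "1 + \<alpha>" 2, where 'a = real] by simp
    then show ?thesis using assms(3) by simp
  qed
  have \<Gamma>: "\<Gamma> = (2 + \<alpha>) div 2"
  proof -
    have "\<lceil>(1 + real \<alpha>) / 2\<rceil> = int ((2 + \<alpha>) div 2)"
    proof -
      have "\<alpha> = 2 * (\<alpha> div 2) \<or> \<alpha> = Suc (2 * (\<alpha> div 2))" by presburger
      then obtain m where "\<alpha> = 2 * m \<or> \<alpha> = Suc (2 * m)" by blast
      then show ?thesis by (auto simp: ceiling_eq_iff)
    qed
    then show ?thesis using assms(4) by simp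
  qed
  \<comment> \<open>\<beta> and \<Gamma> are the rounded-down and rounded-up halves of 1 + \<alpha>.
    Positivity of \<beta> turns the truncated bound \<open>j \<le> \<beta> - 1\<close> into
    \<open>j < \<beta>\<close>.\<close>
  have \<beta>\<Gamma>: "\<beta> \<ge> 1" "\<beta> + \<Gamma> = \<alpha> + 1" using \<alpha> \<beta> \<Gamma> by presburger+
  then have j: "j < \<beta>" using assms(13) by linarith
  have x_finite: "x \<in> generic_finite R"
    using assms(5) \<beta>\<Gamma>(1)
    by (intro generic_finiteI[where n = \<beta>])
      (auto simp: assms(6,7) symb_closed cring.cring_simprules[OF cring_free_boolean_ring])
  interpret generic_division \<nu> R N x c borrows
    using assms(1,6,8-11) x_finite by unfold_locales (simp_all add: assms(7))

  let ?P = "\<lambda>\<Phi>. (\<forall>p\<in>{1..j}. \<Phi> (\<beta> - p) = (0::bit)) \<and> \<Phi> (\<beta> - (j + 1)) = 1"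
  let ?Q = "\<lambda>\<Phi>. inst_int \<Phi> (\<lambda>i. if i < \<Gamma> + j then c i i else \<zero>\<^bsub>R\<^esub>)"
  \<comment> \<open>Bit 0 is the constant 1; only the bits 1 to \<beta> - 1 are read off
    \<Phi>.\<close>
  have bit_x: "Bit_Operations.bit (inst_int \<Phi> x) i \<longleftrightarrow> i = 0 \<or> i < \<beta> \<and> \<Phi> i = 1" for \<Phi> i
    unfolding bit_inst_x by (simp add: assms(7) inst_R poly_ext_symb)
  have x_pos: "inst_int \<Phi> x > 0" for \<Phi>
  proof -
    have "take_bit \<beta> (inst_int \<Phi> x) = inst_int \<Phi> x"
      using \<beta>\<Gamma> by (intro bit_eqI) (auto simp: bit_take_bit_iff bit_x)
    then have "0 \<le> inst_int \<Phi> x" by (metis take_bit_nonnegative)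
    moreover have "inst_int \<Phi> x \<noteq> 0" using bit_x[of \<Phi> 0] by auto
    ultimately show ?thesis by simp
  qed
  have x_odd: "odd (inst_int \<Phi> x)" for \<Phi>
    using bit_x[of \<Phi> 0] by (simp add: bit_0)
  have x_length: "int_length (inst_int \<Phi> x) = \<beta> - j" if P: "?P \<Phi>" for \<Phi>
  proof -
    have "\<Phi> i = 0" if "\<beta> - (j + 1) < i" "i < \<beta>" for i
      \<comment> \<open>An index strictly between \<beta> - (j + 1) and \<beta> is \<beta> - p for p
        = \<beta> - i, which lies in 1..j.\<close>
      using P that by (auto dest!: bspec[of _ _ "\<beta> - i"])
    then have "int_length (inst_int \<Phi> x) = Suc (\<beta> - (j + 1))"
      using P j x_pos by (auto simp: int_length_eq_Suc_iff bit_x)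
    then show ?thesis using j by simp
  qed
  have e_iff: "inst \<Phi> (e (\<Gamma> + j)) = 1 \<longleftrightarrow> N = inst_int \<Phi> x * ?Q \<Phi>" for \<Phi>
    unfolding assms(12) inst_e_eq_1_iff inst_diagonal
    using binary_division.C_eq_B_iff[OF binary_division_inst] .

  have exists: "\<exists>\<Phi>. ?P \<Phi> \<and> inst \<Phi> (e (\<Gamma> + j)) = 1"
    if d: "d > 0" "odd d" "d dvd N" "int_length d = \<beta> - j" for d :: int
  proof -
    \<comment> \<open>\<Phi> copies the bits of d, so that x instantiates to d; oddness of d matches
      the constant component 0.\<close>
    define \<Phi> :: "nat \<Rightarrow> bit" where "\<Phi> i = of_bool (Bit_Operations.bit d i)" for i
    have "int_length d = Suc (\<beta> - (j + 1))" using d(4) j by simp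
    then have top: "Bit_Operations.bit d (\<beta> - (j + 1))"
        "\<And>i. i > \<beta> - (j + 1) \<Longrightarrow> \<not> Bit_Operations.bit d i"
      using d(1) by (simp_all add: int_length_eq_Suc_iff)
    then have P: "?P \<Phi>" using j by (auto simp: \<Phi>_def)
    have x: "inst_int \<Phi> x = d"
    proof (rule bit_eqI)
      fix i
      have "i < \<beta>" if "Bit_Operations.bit d i"
        using top(2)[of i] that j by linarith
      then show "Bit_Operations.bit (inst_int \<Phi> x) i = Bit_Operations.bit d i"
        using d(2) unfolding bit_x by (cases "i = 0") (auto simp: \<Phi>_def bit_0)
    qed
    obtain q where q: "N = d * q" using d(3) by blast
    have "q > 0" using q assms(1) d(1) by (simp add: zero_less_mult_iff)
    have "q < 2 ^ (\<Gamma> + j)"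
    proof (rule ccontr)
      assume "\<not> q < 2 ^ (\<Gamma> + j)"
      \<comment> \<open>The lower bounds on d and q multiply to 2^\<alpha>, which exceeds N. Hence
        \<Gamma> + j division steps capture every digit of q.\<close>
      then have "2 ^ (\<beta> - j - 1) * 2 ^ (\<Gamma> + j) \<le> d * q"
        using int_length_bounds(1)[OF d(1)] d by (intro mult_mono) auto
      moreover have "\<beta> - j - 1 + (\<Gamma> + j) = \<alpha>" using j \<beta>\<Gamma> by linarith
      ultimately have "2 ^ \<alpha> \<le> N" using q by (simp flip: power_add)
      then show False using int_length_bounds(2)[OF assms(1)] assms(2) by simp
    qed
    then have "?Q \<Phi> = q"
      unfolding inst_diagonal using q x \<open>q > 0\<close>
      by (intro binary_division.quotient_eq[OF binary_division_inst]) auto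
    then have "inst \<Phi> (e (\<Gamma> + j)) = 1" unfolding e_iff using q x by simp
    with P show ?thesis by blast
  qed
  have factor: "inst_int \<Phi> x > 0 \<and> ?Q \<Phi> > 0 \<and> N = inst_int \<Phi> x * ?Q \<Phi> \<and>
      N div inst_int \<Phi> x = ?Q \<Phi>" if "inst \<Phi> (e (\<Gamma> + j)) = 1" for \<Phi>
  proof -
    have N: "N = inst_int \<Phi> x * ?Q \<Phi>" using that e_iff by blast
    then have "?Q \<Phi> > 0" using assms(1) x_pos[of \<Phi>] by (metis zero_less_mult_pos)
    moreover have "N div inst_int \<Phi> x = ?Q \<Phi>"
      using N x_pos[of \<Phi>] by (metis nonzero_mult_div_cancel_left less_irrefl)
    ultimately show ?thesis using N x_pos by blast
  qed
  have divisor: "\<exists>d::int. d > 0 \<and> odd d \<and> d dvd N \<and> int_length d = \<beta> - j"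
    if "?P \<Phi>" "inst \<Phi> (e (\<Gamma> + j)) = 1" for \<Phi>
    using factor[OF that(2)] x_length[OF that(1)] x_odd[of \<Phi>]
    by (intro exI[of _ "inst_int \<Phi> x"]) (metis dvd_triv_left)
  show ?thesis
    using exists factor divisor by blast
qed

end
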